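(* Let $X_1,\ldots,X_n$ be independent and identically distributed random variables taking values in the positive integers, with mass function $p(j)=\mathbb{P}(X_1=j)$ and distribution function $F(j)=\mathbb{P}(X_1\leq j)$. Let $M_n=\max\{X_1,\ldots,X_n\}$ and $K_n=|\{i\in\{1,\ldots,n\}:X_i=M_n\}|$. (a) Let $\alpha$ be defined by $1-\alpha=\frac{\mathbb{P}(K_n=1)}{\mathbb{E}[K_n]}$, suppose that $\alpha\in(0,1)$, and let $L\sim\mathrm{L}(\alpha)$ have a logarithmic distribution with parameter $\alpha$. Then $$d_{\mathrm{TV}}(K_n,L)\leq-2n\log(1-\alpha)\sum_{j=1}^\infty p(j)\left(F(j)^{n-1}-\frac{(1-\alpha)(n-1)}{\alpha}p(j)F(j-1)^{n-2}\right).$$ (b) Let $\beta$ be defined by $1-\beta=\frac{\mathbb{E}[K_n]}{\mathbb{E}[K_n^2]}$, suppose that $\beta\in(0,1)$, and let $L\sim\mathrm{L}(\beta)$ have a logarithmic distribution with parameter $\beta$. Then $$d_{\mathrm{TV}}(K_n,L)\leq-2(1+\beta)\log(1-\beta)\,\mathbb{E}[K_n^2]\left(\beta+(1-\beta)\left[\frac{\mathbb{E}[(K_n)_3]}{\mathbb{E}[(K_n)_2]}-\frac{(n-3)\mathbb{E}[(K_n)_2]}{(n-1)\mathbb{E}[K_n]}\right]\right).$$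
   Context: For $\alpha\in(0,1)$, $L\sim\mathrm{L}(\alpha)$ means $\mathbb{P}(L=k)=\frac{-\alpha^k}{k\log(1-\alpha)}$ for $k=1,2,\ldots$. $(k)_\ell=k(k-1)\cdots(k-\ell+1)$ denotes the falling factorial. For random variables $K,L$ supported on $\mathbb{Z}^+=\{0,1,2,\ldots\}$, the total variation distance is $d_{\mathrm{TV}}(K,L)=\sup_{E\subseteq\mathbb{Z}^+}|\mathbb{P}(K\in E)-\mathbb{P}(L\in E)|=\frac12\sum_{j\in\mathbb{Z}^+}|\mathbb{P}(K=j)-\mathbb{P}(L=j)|$. The probability mass function of $K_n$ is $\mathbb{P}(K_n=k)=\binom{n}{k}\sum_{j=1}^\infty p(j)^kF(j-1)^{n-k}$ for $k=1,\ldots,n$. Here $F(0)=0$ and the convention $0^0=1$ is used. *)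

theory Defs
  imports "HOL-Probability.Probability"
begin

text \<open>Both functions are meant for \<open>n \<ge> 1\<close>; \<^const>\<open>Max\<close> of the empty set is unspecified.\<close>

definition sample_max :: "(nat \<Rightarrow> 'a \<Rightarrow> nat) \<Rightarrow> nat \<Rightarrow> 'a \<Rightarrow> nat" where
  "sample_max X n \<omega> = Max ((\<lambda>i. X i \<omega>) ` {1..n})"

definition num_max :: "(nat \<Rightarrow> 'a \<Rightarrow> nat) \<Rightarrow> nat \<Rightarrow> 'a \<Rightarrow> nat" where
  "num_max X n \<omega> = card {i \<in> {1..n}. X i \<omega> = sample_max X n \<omega>}"

definition falling_fact :: "real \<Rightarrow> nat \<Rightarrow> real" where
  "falling_fact x l = (\<Prod>i<l. x - real i)"

text \<open>For \<open>a \<in> (0,1)\<close> the masses at \<open>k \<ge> 1\<close> add up to 1, so \<open>L = 0\<close> has probability 0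
  without this being required separately.\<close>

definition log_distributed :: "'a measure \<Rightarrow> ('a \<Rightarrow> nat) \<Rightarrow> real \<Rightarrow> bool" where
  "log_distributed N L a \<longleftrightarrow>
     prob_space N \<and> L \<in> measurable N (count_space UNIV) \<and>
     (\<forall>k\<ge>1. \<P>(\<omega> in N. L \<omega> = k) = - (a ^ k) / (real k * ln (1 - a)))"

text \<open>The two variables may live on different probability spaces, since only their laws matter.\<close>

definition tv_dist :: "'a measure \<Rightarrow> ('a \<Rightarrow> nat) \<Rightarrow> 'b measure \<Rightarrow> ('b \<Rightarrow> nat) \<Rightarrow> real" where
  "tv_dist M K N L =
     (SUP E \<in> (UNIV :: nat set set). \<bar>\<P>(\<omega> in M. K \<omega> \<in> E) - \<P>(\<omega> in N. L \<omega> \<in> E)\<bar>)"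

end

theory Submission
  imports Defs
begin

text \<open>
  Write \<open>c = - ln (1 - a)\<close> and let \<open>L\<close> be logarithmic with parameter \<open>a\<close>. The size-biased law of
  \<open>L\<close>, with masses proportional to \<open>k P(L = k)\<close>, is geometric, and this yields the Stein equation
  \<open>k (a f(k+1) - f(k)) = 1\<^sub>E(k) - P(L \<in> E)\<close> with \<open>f(1) = 0\<close>. Its explicit solution \<open>log_stein\<close> satisfies
  \<open>\<bar>f\<bar> \<le> c/a\<close> (\<open>log_stein_bound\<close>), and \<open>\<bar>f(k+1) - f(k) - f(2)\<bar> \<le> 4(1+a)c/(3a)\<close> for \<open>k \<ge> 2\<close>
  (\<open>log_stein_diff_bound\<close>). With \<open>Q\<^sub>k = k P(K = k)\<close>, the difference \<open>P(K \<in> E) - P(L \<in> E)\<close> equals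
  \<open>\<Sum>\<^sub>k Q\<^sub>k (a f(k+1) - f(k))\<close>, so that it suffices to bound this sum (\<open>tv_dist_le\<close>).

  In the first part the parameter is chosen so that \<open>Q\<^sub>1 = (1 - a) E K\<close>. Then the terms of the sum with
  \<open>a f(k+1)\<close>, and those with \<open>f(k)\<close> for \<open>k \<ge> 2\<close>, carry the same total mass \<open>a E K\<close>. Cancelling what
  both put on \<open>f(2)\<close> and using \<open>\<bar>f\<bar> \<le> c/a\<close> for the rest bounds the sum by \<open>2c (E K - 2 (1 - a)/a P(K = 2))\<close>
  (\<open>stein_sum_bound_of_first_mass\<close>), which is the asserted series by the formula for the mass
  function of \<open>K\<close>.

  In the second part the parameter is chosen so that \<open>E K = (1 - b) E K\<^sup>2\<close>, which makes the sum vanish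
  for \<open>f(k) = k - 1\<close>. Hence \<open>f\<close> may be replaced by \<open>f(k) - (k - 1) f(2)\<close>, whose increments vanish
  at \<open>1\<close> and are controlled by \<open>log_stein_diff_bound\<close> from \<open>2\<close> on; this bounds the sum by
  \<open>4(1+b)c/(3b) (b\<^sup>2 E K\<^sup>2 + (1 - b) E (K)\<^sub>3 / 2)\<close> (\<open>stein_sum_bound_of_mean\<close>). The factorial moments are
  \<open>E (K)\<^sub>l = (n)\<^sub>l \<Sum>\<^sub>j p(j)\<^sup>l F(j)\<^sup>n\<^sup>-\<^sup>l\<close> (\<open>falling_moment_sums\<close>), whence by Cauchy--Schwarz
  \<open>(n - 2) (E (K)\<^sub>2)\<^sup>2 \<le> (n - 1) E (K)\<^sub>3 E K\<close>. This says that the term \<open>E (K)\<^sub>3\<close> is large enough for the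
  asserted right-hand side to dominate the bound just obtained (\<open>moment_bound_rearrange\<close>).
\<close>

section \<open>Inequalities for the logarithm\<close>

lemma neg_ln_one_minus_sums:
  fixes a :: real
  assumes "0 < a" "a < 1"
  shows "(\<lambda>i. a ^ Suc i / real (Suc i)) sums (- ln (1 - a))"
proof -
  have "(\<lambda>n. - (a ^ n) / real n) sums ln (1 - a)"
    using ln_series'[of "- a"] assms by simp
 from sums_minus[OF this] have "(\<lambda>n. a ^ n / real n) sums (- ln (1 - a))" by simp
  then show ?thesis by (subst sums_Suc_iff) simp
qed

lemma neg_ln_one_minus_ge:
  fixes a :: real
  assumes "0 < a" "a < 1"
  shows "a \<le> - ln (1 - a)"
  using ln_le_minus_one[of "1 - a"] assms by simp

text \<open>  The two sides agree up to second order at \<open>a = 0\<close>, which the bound on \<open>log_stein\<close> at \<open>2\<close> needs.\<close>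

lemma neg_ln_one_minus_le:
  fixes a :: real
  assumes "0 < a" "a < 1"
  shows "(1 - a) * (2 + a) * (- ln (1 - a)) \<le> 2 * a"
proof -
  \<comment> \<open>The partial fraction form of \<open>2 x / ((1 - x) (2 + x)) + ln (1 - x)\<close>.\<close>
  define h where "h x = 2 / 3 * inverse (1 - x) - 4 / 3 * inverse (2 + x) + ln (1 - x)" for x :: real
  have "h 0 \<le> h a"
  proof (rule DERIV_nonneg_imp_nondecreasing[where f = h])
    fix x :: real
    assume x: "0 \<le> x" "x \<le> a"
    then have pos: "0 < 1 - x" "0 < 2 + x" using assms by auto
    define u v where "u = inverse (1 - x)" and "v = inverse (2 + x)"
    have uv: "u * (1 - x) = 1" "v * (2 + x) = 1" using pos by (auto simp: u_def v_def)
    have "(h has_real_derivative 2 / 3 * u^2 + 4 / 3 * v^2 - u) (at x)"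
      unfolding h_def u_def v_def using pos
      by (auto intro!: derivative_eq_intros simp: power2_eq_square divide_inverse[of 1])
    moreover have "2 / 3 * u^2 + 4 / 3 * v^2 - u = x^2 * (5 + x) * u^2 * v^2"
    proof -
      have "2 / 3 * u^2 + 4 / 3 * v^2 - u
          = 2 / 3 * u^2 * (v * (2 + x))^2 + 4 / 3 * v^2 * (u * (1 - x))^2 - u * (u * (1 - x)) * (v * (2 + x))^2"
        unfolding uv by simp
      also have "\<dots> = (2 / 3 * (2 + x)^2 + 4 / 3 * (1 - x)^2 - (1 - x) * (2 + x)^2) * u^2 * v^2"
        by (simp only: power_mult_distrib power2_eq_square algebra_simps)
      also have "2 / 3 * (2 + x)^2 + 4 / 3 * (1 - x)^2 - (1 - x) * (2 + x)^2 = x^2 * (5 + x)"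
        by (simp add: power2_eq_square field_simps)
      finally show ?thesis .
    qed
    moreover have "0 \<le> x^2 * (5 + x) * u^2 * v^2" using x by simp
    ultimately show "\<exists>y. (h has_real_derivative y) (at x) \<and> 0 \<le> y" by metis
  qed (use assms in auto)
  moreover have "h 0 = 0" by (simp add: h_def)
  moreover have "h a = 2 * a / ((1 - a) * (2 + a)) + ln (1 - a)"
    using assms by (simp add: h_def divide_simps) (simp add: algebra_simps)
  ultimately have "- ln (1 - a) \<le> 2 * a / ((1 - a) * (2 + a))" by linarith
  then show ?thesis using assms by (simp add: pos_le_divide_eq mult.commute)
qed

section \<open>The Stein equation of the logarithmic law\<close>

text \<open>  Properties of \<open>g(k) = 1\<^sub>E(k) - P(L \<in> E)\<close> for \<open>L\<close> logarithmic with parameter \<open>a\<close>: it is bounded by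
  \<open>1\<close>, bounded at \<open>1\<close> by \<open>P(L \<noteq> 1) = 1 + a / ln (1 - a)\<close>, and has mean \<open>0\<close>. The mean is written with
  the unnormalised masses \<open>a\<^sup>k / k\<close>, and \<open>k = i + 1\<close> to start the series at the mass of \<open>1\<close>.\<close>

definition log_centred :: "real \<Rightarrow> (nat \<Rightarrow> real) \<Rightarrow> bool" where
  "log_centred a g \<longleftrightarrow> (\<forall>k. \<bar>g k\<bar> \<le> 1) \<and> \<bar>g 1\<bar> \<le> 1 + a / ln (1 - a) \<and>
     (\<lambda>i. a ^ Suc i / real (Suc i) * g (Suc i)) sums 0"

text \<open>  The solution \<open>f\<close> of \<open>k (a f(k+1) - f(k)) = g(k)\<close>, \<open>k \<ge> 1\<close>, with \<open>f(1) = 0\<close>. The value at \<open>0\<close> is \<open>0\<close>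
  and plays no role.\<close>

definition log_stein :: "real \<Rightarrow> (nat \<Rightarrow> real) \<Rightarrow> nat \<Rightarrow> real" where
  "log_stein a g k = (\<Sum>j=1..<k. a ^ j / real j * g j) / a ^ k"

lemma log_stein_1 [simp]: "log_stein a g 1 = 0" "log_stein a g (Suc 0) = 0"
  by (simp_all add: log_stein_def)

lemma log_stein_rec:
  assumes "a \<noteq> 0" "k \<ge> 1"
  shows "real k * (a * log_stein a g (Suc k) - log_stein a g k) = g k"
proof -
  have "(\<Sum>j=1..<Suc k. a ^ j / real j * g j) = (\<Sum>j=1..<k. a ^ j / real j * g j) + a ^ k / real k * g k"
    using assms by simp
  then show ?thesis using assms unfolding log_stein_def
    by (simp add: field_simps)
qed

text \<open>  Since \<open>g\<close> has mean \<open>0\<close>, the partial sum defining \<open>f(k+1)\<close> is minus the tail of the series, and thus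
  \<open>\<bar>f(k+1)\<bar> \<le> \<Sum>\<^sub>i a\<^sup>i / (k + 1 + i)\<close>. The following bounds majorise this series term by term.\<close>

lemma log_stein_le:
  assumes a: "0 < a" "a < 1" and g: "log_centred a g"
    and b: "\<And>i. a ^ i / real (k + Suc i) \<le> b i" "b sums C"
  shows "\<bar>log_stein a g (Suc k)\<bar> \<le> C"
proof -
  define u where "u i = a ^ Suc i / real (Suc i) * g (Suc i)" for i
  define S where "S = (\<Sum>i<k. u i)"
  have stein: "log_stein a g (Suc k) = S / a ^ Suc k"
    unfolding log_stein_def S_def u_def
    using sum.shift_bounds_Suc_ivl[of "\<lambda>j. a ^ j / real j * g j" 0 k]
    by (simp only: One_nat_def atLeast0LessThan)
  have "u sums 0" using g unfolding log_centred_def u_def[abs_def] by blast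
  then have "(\<lambda>i. u (i + k)) sums (0 - S)"
    unfolding S_def by (rule sums_split_initial_segment)
  then have s: "(\<lambda>i. u (i + k) / a ^ Suc k) sums (- (S / a ^ Suc k))"
    using sums_divide by fastforce
  have "\<bar>u (i + k) / a ^ Suc k\<bar> \<le> b i" for i
  proof -
    have "u (i + k) / a ^ Suc k = a ^ i / real (k + Suc i) * g (Suc (i + k))"
    proof -
      have "a ^ Suc (i + k) = a ^ i * a ^ Suc k" by (simp add: power_add)
      moreover have "Suc (i + k) = k + Suc i" by simp
      ultimately show ?thesis using a by (simp only: u_def) (simp del: of_nat_Suc power_Suc of_nat_add)
    qed
    also have "\<bar>\<dots>\<bar> \<le> a ^ i / real (k + Suc i) * 1"
      unfolding abs_mult using g a by (intro mult_mono) (auto simp: log_centred_def)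
    finally show ?thesis using b(1)[of i] by simp
  qed
  then have "u (i + k) / a ^ Suc k \<le> b i" "- b i \<le> u (i + k) / a ^ Suc k" for i
    using abs_le_D1 abs_le_D2 minus_le_iff by blast+
  then have "- (S / a ^ Suc k) \<le> C" "- C \<le> - (S / a ^ Suc k)"
    using sums_le[OF _ s b(2)] sums_le[OF _ sums_minus[OF b(2)] s] by auto
  then show ?thesis using stein by (simp add: abs_le_iff)
qed

lemma sums_pow_div_Suc:
  fixes a :: real
  assumes "0 < a" "a < 1"
  shows "(\<lambda>i. a ^ i / real (Suc i)) sums (- ln (1 - a) / a)"
  using sums_divide[OF neg_ln_one_minus_sums[OF assms], of a] assms by simp

lemma log_stein_bound:
  assumes a: "0 < a" "a < 1" and g: "log_centred a g"
  shows "\<bar>log_stein a g k\<bar> \<le> - ln (1 - a) / a"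
proof (cases k)
  case 0
  then show ?thesis using a by (simp add: log_stein_def divide_nonpos_pos)
next
  case (Suc k')
  have "\<bar>log_stein a g (Suc k')\<bar> \<le> - ln (1 - a) / a"
    by (rule log_stein_le[OF a g _ sums_pow_div_Suc[OF a]]) (use a in \<open>auto intro!: divide_left_mono\<close>)
  then show ?thesis using Suc by simp
qed

lemma log_stein_bound_ge_3:
  assumes a: "0 < a" "a < 1" and g: "log_centred a g" and k: "k \<ge> 3"
  shows "\<bar>log_stein a g k\<bar> \<le> - ln (1 - a) / a - 2 / 3"
proof -
  obtain k' where k': "k = Suc k'" "k' \<ge> 2" using k by (cases k) auto
  \<comment> \<open>For \<open>k' \<ge> 2\<close> the term at \<open>i = 0\<close> is at most \<open>1/3\<close> instead of \<open>1\<close>, which saves \<open>2/3\<close>.\<close>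
  define b where "b i = a ^ i / real (Suc i) - (if i = 0 then 2 / 3 else 0)" for i
  have s: "b sums (- ln (1 - a) / a - 2 / 3)"
    unfolding b_def by (intro sums_diff sums_pow_div_Suc a) (rule sums_single[of 0 "\<lambda>_. 2/3 :: real"])
  have "a ^ i / real (k' + Suc i) \<le> b i" for i
  proof (cases "i = 0")
    case True
    then show ?thesis using k' by (simp add: b_def field_simps)
  next
    case False
    then show ?thesis using a by (auto simp: b_def intro!: divide_left_mono)
  qed
  from log_stein_le[OF a g this s] show ?thesis using k' by simp
qed

lemma log_stein_2_bound:
  assumes a: "0 < a" "a < 1" and g: "log_centred a g"
  shows "2 * \<bar>log_stein a g 2\<bar> \<le> 1 + a"
proof -
  define c where "c = - ln (1 - a)"
  have c: "a \<le> c" "(1 - a) * (2 + a) * c \<le> 2 * a"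
    using neg_ln_one_minus_ge[OF a] neg_ln_one_minus_le[OF a] by (auto simp: c_def)
  have "log_stein a g 2 = g 1 / a"
    using log_stein_rec[of a 1 g] a by (simp add: field_simps numeral_2_eq_2)
  then have "\<bar>log_stein a g 2\<bar> \<le> (1 - a / c) / a"
    using g a by (auto simp: log_centred_def c_def divide_right_mono)
  also have "\<dots> \<le> (1 + a) / 2"
  proof -
    have "2 * c - 2 * a \<le> a * (1 + a) * c" using c(2) by (simp add: algebra_simps)
    then show ?thesis using a c by (simp add: field_simps)
  qed
  finally show ?thesis by simp
qed

text \<open>  The constant \<open>4/3\<close> is small enough for \<open>moment_bound_rearrange\<close> below. The estimates leave no
  room at \<open>k = 2\<close>: there \<open>2 \<bar>f(2)\<bar> + \<bar>f(3)\<bar> \<le> (1 + a) + (c/a - 2/3)\<close>, and both this and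
  \<open>4(1+a)c/(3a)\<close> tend to \<open>4/3\<close> as \<open>a\<close> tends to \<open>0\<close>. Here \<open>c = - ln (1 - a)\<close>.\<close>

lemma log_stein_diff_bound:
  assumes a: "0 < a" "a < 1" and g: "log_centred a g" and k: "k \<ge> 2"
  shows "\<bar>log_stein a g (Suc k) - log_stein a g k - log_stein a g 2\<bar>
           \<le> 4 / 3 * (1 + a) * (- ln (1 - a)) / a"
proof -
  define c where "c = - ln (1 - a)"
  have c: "a \<le> c" "(1 - a) * (2 + a) * c \<le> 2 * a"
    using neg_ln_one_minus_ge[OF a] neg_ln_one_minus_le[OF a] by (auto simp: c_def)
  define r where "r = c / a"
  have r: "1 \<le> r" using a c by (simp add: r_def)
  have f2: "2 * \<bar>log_stein a g 2\<bar> \<le> 1 + a" by (rule log_stein_2_bound[OF a g])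
  have f3: "\<bar>log_stein a g j\<bar> \<le> r - 2 / 3" if "j \<ge> 3" for j
    using log_stein_bound_ge_3[OF a g that] by (simp add: c_def r_def)
  have r_mult: "4 / 3 * (1 + a) * r = 4 / 3 * r + 4 / 3 * c" using a by (simp add: r_def field_simps)
  have "\<bar>log_stein a g (Suc k) - log_stein a g k - log_stein a g 2\<bar> \<le> 4 / 3 * (1 + a) * r"
  proof (cases "k = 2")
    case True
    have "\<bar>log_stein a g 3 - log_stein a g 2 - log_stein a g 2\<bar> \<le> 4 / 3 * (1 + a) * r"
      using f2 f3[OF order_refl] c(1) r a(1) r_mult by linarith
    then show ?thesis using True by simp
  next
    case False
    then have "\<bar>log_stein a g (Suc k)\<bar> \<le> r - 2 / 3" "\<bar>log_stein a g k\<bar> \<le> r - 2 / 3"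
      using f3 k by auto
    moreover have "2 / 3 * r \<le> 5 / 6 - 1 / 2 * a + 4 / 3 * c"
    proof -
      have "(1 - a) * c * 2 \<le> (1 - a) * c * (2 + a)" using a c by (intro mult_left_mono) auto
      then have "c \<le> a + a * c" using c(2) by (simp add: algebra_simps)
      then have "r \<le> 1 + c" using a by (simp add: r_def field_simps)
      then show ?thesis using a c by linarith
    qed
    ultimately show ?thesis using f2 r_mult by linarith
  qed
  then show ?thesis by (simp add: c_def r_def)
qed

section \<open>Bounds on the Stein sum\<close>

lemma stein_sum_bound_of_first_mass:
  fixes Q f :: "nat \<Rightarrow> real"
  assumes n: "n \<ge> 2" and a: "0 < a" "a < 1" and Q: "\<And>k. Q k \<ge> 0"
    and Q1: "Q 1 = (1 - a) * (\<Sum>k=1..n. Q k)"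
    and f1: "f 1 = 0" and fB: "\<And>k. \<bar>f k\<bar> \<le> B"
  shows "\<bar>\<Sum>k=1..n. Q k * (a * f (Suc k) - f k)\<bar>
           \<le> 2 * a * B * ((\<Sum>k=1..n. Q k) - (1 - a) / a * Q 2)"
proof -
  define m where "m = (\<Sum>k=1..n. Q k)"
  define U where "U = (\<Sum>k=2..n. Q k * f (Suc k))"
  define V where "V = (\<Sum>k=3..n. Q k * f k)"
  have B: "0 \<le> B" using fB[of 0] by linarith
  have split1: "(\<Sum>k=1..n. h k) = h 1 + (\<Sum>k=2..n. h k)" for h :: "nat \<Rightarrow> real"
    using n by (simp add: sum.atLeast_Suc_atMost numeral_2_eq_2)
  have split2: "(\<Sum>k=2..n. h k) = h 2 + (\<Sum>k=3..n. h k)" for h :: "nat \<Rightarrow> real"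
    using n by (simp add: sum.atLeast_Suc_atMost numeral_3_eq_3)
  have m2: "(\<Sum>k=2..n. Q k) = a * m" using split1[of Q] Q1 by (simp add: m_def algebra_simps)
  have m3: "(\<Sum>k=3..n. Q k) = a * m - Q 2" using split2[of Q] m2 by simp
  have "\<bar>U\<bar> \<le> (\<Sum>k=2..n. Q k * B)" unfolding U_def
    by (rule sum_abs[THEN order_trans], rule sum_mono) (use Q fB in \<open>auto simp: abs_mult intro!: mult_mono\<close>)
  then have U: "\<bar>U\<bar> \<le> a * m * B" by (simp add: sum_distrib_right[symmetric] m2)
  have "\<bar>V\<bar> \<le> (\<Sum>k=3..n. Q k * B)" unfolding V_def
    by (rule sum_abs[THEN order_trans], rule sum_mono) (use Q fB in \<open>auto simp: abs_mult intro!: mult_mono\<close>)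
  then have V: "\<bar>V\<bar> \<le> (a * m - Q 2) * B" by (simp add: sum_distrib_right[symmetric] m3)
  have m0: "0 \<le> m" unfolding m_def using Q by (simp add: sum_nonneg)
  have Q2: "Q 2 \<le> a * m" using m3 Q by (metis diff_ge_0_iff_ge sum_nonneg)
  have "(\<Sum>k=1..n. Q k * (a * f (Suc k) - f k))
      = a * (\<Sum>k=1..n. Q k * f (Suc k)) - (\<Sum>k=1..n. Q k * f k)"
    by (simp add: sum_distrib_left sum_subtractf[symmetric] algebra_simps)
  also have "(\<Sum>k=1..n. Q k * f (Suc k)) = (1 - a) * m * f 2 + U"
    unfolding split1[of "\<lambda>k. Q k * f (Suc k)"] U_def using Q1 by (simp add: m_def numeral_2_eq_2)
  also have "(\<Sum>k=1..n. Q k * f k) = Q 2 * f 2 + V"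
    unfolding split1[of "\<lambda>k. Q k * f k"] split2[of "\<lambda>k. Q k * f k"] V_def using f1 by simp
  also have "a * ((1 - a) * m * f 2 + U) - (Q 2 * f 2 + V) = (a * ((1 - a) * m) - Q 2) * f 2 + a * U - V"
    by (simp add: algebra_simps)
  \<comment> \<open>The contributions to \<open>f 2\<close> from both shifts are collected before absolute values are taken.\<close>
  finally have eq: "(\<Sum>k=1..n. Q k * (a * f (Suc k) - f k)) = (a * ((1 - a) * m) - Q 2) * f 2 + a * U - V" .
  have "\<bar>(a * ((1 - a) * m) - Q 2) * f 2\<bar> \<le> \<bar>a * ((1 - a) * m) - Q 2\<bar> * B"
    unfolding abs_mult using fB by (intro mult_left_mono) auto
  moreover have "\<bar>a * U\<bar> \<le> a * (a * m * B)" unfolding abs_mult using U a by (intro mult_mono) auto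
  ultimately have "\<bar>\<Sum>k=1..n. Q k * (a * f (Suc k) - f k)\<bar>
      \<le> \<bar>a * ((1 - a) * m) - Q 2\<bar> * B + a * (a * m * B) + (a * m - Q 2) * B"
    unfolding eq using V by linarith
  also have "\<dots> = (\<bar>a * ((1 - a) * m) - Q 2\<bar> + a * (a * m) + (a * m - Q 2)) * B"
    by (simp add: algebra_simps)
  also have "\<dots> \<le> 2 * (a * m - (1 - a) * Q 2) * B"
  proof (rule mult_right_mono[OF _ B])
    have "0 \<le> (1 - a) * (a * m - Q 2)" using a Q2 by simp
    moreover have "0 \<le> a * Q 2" using a Q by simp
    ultimately show "\<bar>a * ((1 - a) * m) - Q 2\<bar> + a * (a * m) + (a * m - Q 2) \<le> 2 * (a * m - (1 - a) * Q 2)"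
      by (simp add: abs_if algebra_simps)
  qed
  also have "\<dots> = 2 * a * B * (m - (1 - a) / a * Q 2)" using a by (simp add: field_simps)
  finally show ?thesis by (simp add: m_def)
qed
lemma stein_sum_bound_of_mean:
  fixes Q f :: "nat \<Rightarrow> real"
  assumes a: "0 < a" "a < 1" and Q: "\<And>k. Q k \<ge> 0"
    and mean: "(\<Sum>k=1..n. Q k) = (1 - a) * (\<Sum>k=1..n. real k * Q k)"
    and f1: "f 1 = 0" and fD: "\<And>k. k \<ge> 2 \<Longrightarrow> \<bar>f (Suc k) - f k - f 2\<bar> \<le> D"
  shows "\<bar>\<Sum>k=1..n. Q k * (a * f (Suc k) - f k)\<bar>
           \<le> D * (a\<^sup>2 * (\<Sum>k=1..n. real k * Q k)
                  + (1 - a) / 2 * (\<Sum>k=1..n. (real k - 1) * (real k - 2) * Q k))"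
proof -
  define m2 where "m2 = (\<Sum>k=1..n. real k * Q k)"
  \<comment> \<open>The mean condition says that \<open>f k = k - 1\<close> contributes \<open>0\<close> to the sum, so \<open>f\<close> may be
    normalised to vanish at \<open>2\<close> as well as at \<open>1\<close>.\<close>
  define e where "e k = f k - (real k - 1) * f 2" for k
  have D: "0 \<le> D" using fD[of 2] by linarith
  have e_step: "\<bar>e (Suc k) - e k\<bar> \<le> D" if "k \<ge> 2" for k
    using fD[OF that] by (simp add: e_def algebra_simps)
  have e_bound: "\<bar>e (k + 2)\<bar> \<le> D * real k" for k
  proof (induction k)
    case 0
    then show ?case by (simp add: e_def numeral_2_eq_2)
  next
    case (Suc k)
    then show ?case using e_step[of "k + 2"] by (simp add: algebra_simps)
  qed
  have pw: "\<bar>a * f (Suc k) - f k - (a * real k - (real k - 1)) * f 2\<bar>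
      \<le> D * (a * (real k - 1) + (1 - a) / 2 * ((real k - 1) * (real k - 2)))" if "k \<ge> 1" for k
  proof -
    have eq: "a * f (Suc k) - f k - (a * real k - (real k - 1)) * f 2
        = a * (e (Suc k) - e k) - (1 - a) * e k"
      by (simp add: e_def algebra_simps)
    show ?thesis
    proof (cases "k = 1")
      case True
      then show ?thesis using f1 by (simp add: numeral_2_eq_2)
    next
      case False
      then have "2 \<le> k" using that by simp
      then obtain j where j: "k = j + 2" by (metis le_add_diff_inverse2)
      have "real j \<le> (real k - 1) * (real k - 2) / 2"
      proof (cases j)
        case (Suc i)
        then show ?thesis using j by (simp add: field_simps)
      qed (use j in simp)
      then have "D * real j \<le> D * ((real k - 1) * (real k - 2) / 2)" using D by (rule mult_left_mono)
      then have "\<bar>e k\<bar> \<le> D * ((real k - 1) * (real k - 2) / 2)" using e_bound[of j] j by simp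
      then have 1: "\<bar>(1 - a) * e k\<bar> \<le> (1 - a) * (D * ((real k - 1) * (real k - 2) / 2))"
        unfolding abs_mult using a by (intro mult_mono) auto
      have "\<bar>e (Suc k) - e k\<bar> \<le> D * 1" using e_step[of k] j by simp
      also have "\<dots> \<le> D * (real k - 1)" using j D by (intro mult_left_mono) auto
      finally have 2: "\<bar>a * (e (Suc k) - e k)\<bar> \<le> a * (D * (real k - 1))"
        unfolding abs_mult using a by (intro mult_mono) auto
      have "\<bar>a * (e (Suc k) - e k) - (1 - a) * e k\<bar>
          \<le> a * (D * (real k - 1)) + (1 - a) * (D * ((real k - 1) * (real k - 2) / 2))"
        using 1 2 by linarith
      then show ?thesis unfolding eq by (simp only: distrib_left) (simp only: mult_ac times_divide_eq_right times_divide_eq_left)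
    qed
  qed
  have "(\<Sum>k=1..n. Q k * ((a * real k - (real k - 1)) * f 2))
      = (a * m2 - m2 + (\<Sum>k=1..n. Q k)) * f 2"
    unfolding m2_def by (simp add: sum_distrib_left sum_distrib_right sum.distrib[symmetric] sum_subtractf[symmetric] algebra_simps)
  also have "\<dots> = 0" unfolding mean m2_def by (simp add: algebra_simps)
  finally have "(\<Sum>k=1..n. Q k * (a * f (Suc k) - f k))
      = (\<Sum>k=1..n. Q k * (a * f (Suc k) - f k - (a * real k - (real k - 1)) * f 2))"
    by (simp add: right_diff_distrib sum_subtractf)
  then have "\<bar>\<Sum>k=1..n. Q k * (a * f (Suc k) - f k)\<bar>
      = \<bar>\<Sum>k=1..n. Q k * (a * f (Suc k) - f k - (a * real k - (real k - 1)) * f 2)\<bar>" by (rule arg_cong)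
  also have "\<dots> \<le> (\<Sum>k=1..n. Q k * (D * (a * (real k - 1) + (1 - a) / 2 * ((real k - 1) * (real k - 2)))))"
  proof (rule sum_abs[THEN order_trans], rule sum_mono)
    fix k assume "k \<in> {1..n}"
    then have "k \<ge> 1" by simp
    show "\<bar>Q k * (a * f (Suc k) - f k - (a * real k - (real k - 1)) * f 2)\<bar>
        \<le> Q k * (D * (a * (real k - 1) + (1 - a) / 2 * ((real k - 1) * (real k - 2))))"
      unfolding abs_mult abs_of_nonneg[OF Q] by (rule mult_left_mono[OF pw[OF \<open>k \<ge> 1\<close>] Q])
  qed
  also have "\<dots> = (\<Sum>k=1..n. D * a * (real k * Q k) - D * a * Q k
      + D * ((1 - a) / 2) * ((real k - 1) * (real k - 2) * Q k))"
  proof -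
    have "q * (D * (a * (x - 1) + r * y)) = D * a * (x * q) - D * a * q + D * r * (y * q)"
      for q x r y :: real by (simp add: algebra_simps)
    then show ?thesis by (simp only:)
  qed
  also have "\<dots> = D * a * m2 - D * a * (\<Sum>k=1..n. Q k)
      + D * ((1 - a) / 2) * (\<Sum>k=1..n. (real k - 1) * (real k - 2) * Q k)"
    unfolding m2_def by (simp only: sum.distrib sum_subtractf sum_distrib_left)
  also have "\<dots> = D * (a * (m2 - (\<Sum>k=1..n. Q k))
      + (1 - a) / 2 * (\<Sum>k=1..n. (real k - 1) * (real k - 2) * Q k))"
    by (simp only: right_diff_distrib distrib_left mult.assoc)
  also have "a * (m2 - (\<Sum>k=1..n. Q k)) = a\<^sup>2 * m2"
    unfolding mean m2_def by (simp add: algebra_simps power2_eq_square)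
  finally show ?thesis by (simp add: m2_def)
qed

section \<open>Reduction of the total variation distance\<close>

lemma (in prob_space) expectation_finite_range:
  fixes f :: "nat \<Rightarrow> real"
  assumes K: "K \<in> measurable M (count_space UNIV)" and A: "finite A" "\<And>\<omega>. \<omega> \<in> space M \<Longrightarrow> K \<omega> \<in> A"
  shows "expectation (\<lambda>\<omega>. f (K \<omega>)) = (\<Sum>k\<in>A. prob {\<omega> \<in> space M. K \<omega> = k} * f k)"
proof -
  have sets: "{\<omega> \<in> space M. K \<omega> = k} \<in> sets M" for k using K by measurable
  have "expectation (\<lambda>\<omega>. f (K \<omega>))
      = expectation (\<lambda>\<omega>. \<Sum>k\<in>A. indicator {\<omega> \<in> space M. K \<omega> = k} \<omega> * f k)"
  proof (rule Bochner_Integration.integral_cong[OF refl])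
    fix \<omega> assume \<omega>: "\<omega> \<in> space M"
    have "(\<Sum>k\<in>A. indicator {\<omega> \<in> space M. K \<omega> = k} \<omega> * f k) = (\<Sum>k\<in>A. if K \<omega> = k then f k else 0)"
      using \<omega> by (intro sum.cong) (auto simp: indicator_def)
    also have "\<dots> = f (K \<omega>)" using A \<omega> by simp
    finally show "f (K \<omega>) = (\<Sum>k\<in>A. indicator {\<omega> \<in> space M. K \<omega> = k} \<omega> * f k)" by simp
  qed
  also have "\<dots> = (\<Sum>k\<in>A. expectation (\<lambda>\<omega>. indicator {\<omega> \<in> space M. K \<omega> = k} \<omega> * f k))"
    using sets by (intro Bochner_Integration.integral_sum integrable_mult_left)
      (auto intro!: integrable_real_indicator simp: emeasure_eq_measure)
  also have "\<dots> = (\<Sum>k\<in>A. prob {\<omega> \<in> space M. K \<omega> = k} * f k)"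
    using sets by (intro sum.cong refl) (simp add: Int_absorb1)
  finally show ?thesis .
qed

lemma (in prob_space) prob_in_sums:
  fixes L :: "'a \<Rightarrow> nat"
  assumes L: "L \<in> measurable M (count_space UNIV)"
  shows "(\<lambda>j. prob {\<omega> \<in> space M. L \<omega> = j} * indicator E j) sums prob {\<omega> \<in> space M. L \<omega> \<in> E}"
proof -
  let ?A = "\<lambda>j. {\<omega> \<in> space M. L \<omega> = j \<and> j \<in> E}"
  have "?A j \<in> sets M" for j using L by measurable
  then have "(\<lambda>j. prob (?A j)) sums prob (\<Union>j. ?A j)"
    by (intro finite_measure_UNION) (auto simp: disjoint_family_on_def)
  moreover have "(\<Union>j. ?A j) = {\<omega> \<in> space M. L \<omega> \<in> E}" by auto
  moreover have "prob (?A j) = prob {\<omega> \<in> space M. L \<omega> = j} * indicator E j" for j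
    by (cases "j \<in> E") auto
  ultimately show ?thesis by simp
qed

lemma log_distributed_centred:
  assumes L: "log_distributed N L a" and a: "0 < a" "a < 1"
  shows "log_centred a (\<lambda>k. indicator E k - \<P>(\<omega> in N. L \<omega> \<in> E))"
proof -
  define e where "e = \<P>(\<omega> in N. L \<omega> \<in> E)"
  define P where "P k = \<P>(\<omega> in N. L \<omega> = k)" for k
  define c where "c = - ln (1 - a)"
  interpret N: prob_space N using L by (simp add: log_distributed_def)
  have meas: "L \<in> measurable N (count_space UNIV)" using L by (simp add: log_distributed_def)
  have c: "c > 0" using a by (simp add: c_def)
  have P: "P (Suc i) = a ^ Suc i / real (Suc i) / c" for i
    using L by (auto simp: log_distributed_def P_def c_def)
  have e01: "0 \<le> e" "e \<le> 1" by (auto simp: e_def)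
  have "(\<lambda>i. P (Suc i)) sums 1"
    using sums_divide[OF neg_ln_one_minus_sums[OF a], of c] c unfolding P by (simp add: c_def)
  moreover have "P sums 1"
    using N.prob_in_sums[OF meas, of UNIV] N.prob_space by (simp add: P_def[abs_def])
  ultimately have P0: "P 0 = 0"
    using sums_unique2 sums_Suc_iff[of P] by fastforce
  have "(\<lambda>j. P j * indicator E j) sums e"
    using N.prob_in_sums[OF meas, of E] by (simp add: P_def[abs_def] e_def)
  then have "(\<lambda>i. P (Suc i) * indicator E (Suc i)) sums e"
    by (subst sums_Suc_iff) (simp add: P0)
  from sums_mult[OF sums_diff[OF this sums_mult[OF \<open>(\<lambda>i. P (Suc i)) sums 1\<close>, of e]], of c]
  have "(\<lambda>i. c * (P (Suc i) * indicator E (Suc i) - e * P (Suc i))) sums 0" by simp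
  moreover have "c * (P (Suc i) * indicator E (Suc i) - e * P (Suc i))
      = a ^ Suc i / real (Suc i) * (indicator E (Suc i) - e)" for i
  proof -
    have "c * (P (Suc i) * indicator E (Suc i) - e * P (Suc i)) = c * P (Suc i) * (indicator E (Suc i) - e)"
      by (simp add: algebra_simps)
    then show ?thesis using c unfolding P by simp
  qed
  ultimately have s: "(\<lambda>i. a ^ Suc i / real (Suc i) * (indicator E (Suc i) - e)) sums 0" by (simp only:)
  have sets: "{\<omega> \<in> space N. L \<omega> \<in> F} \<in> sets N" for F using meas by measurable
  have "\<bar>indicator E 1 - e\<bar> \<le> 1 - P 1"
  proof (cases "(1::nat) \<in> E")
    case True
    then have "P 1 \<le> e" unfolding P_def e_def using sets by (intro N.finite_measure_mono) auto
    then show ?thesis using True e01 by simp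
  next
    case False
    have "P 1 + e = \<P>(\<omega> in N. L \<omega> \<in> insert 1 E)"
    proof -
      have "{\<omega> \<in> space N. L \<omega> \<in> insert 1 E} = {\<omega> \<in> space N. L \<omega> = 1} \<union> {\<omega> \<in> space N. L \<omega> \<in> E}" by auto
      then show ?thesis unfolding P_def e_def using False sets[of "{1}"] sets[of E]
        by (auto intro!: N.finite_measure_Union[symmetric])
    qed
    also have "\<dots> \<le> 1" by simp
    finally show ?thesis using False e01 by simp
  qed
  also have "1 - P 1 = 1 + a / ln (1 - a)" using P[of 0] by (simp add: c_def)
  finally have g1: "\<bar>indicator E 1 - e\<bar> \<le> 1 + a / ln (1 - a)" .
  have "\<bar>indicator E k - e\<bar> \<le> 1" for k using e01 by (auto simp: indicator_def)
  then show ?thesis using s g1 unfolding log_centred_def e_def by blast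
qed

lemma tv_dist_le:
  assumes M: "prob_space M" and K: "K \<in> measurable M (count_space UNIV)"
    and range: "\<And>\<omega>. \<omega> \<in> space M \<Longrightarrow> K \<omega> \<in> {1..n}"
    and L: "log_distributed N L a" and a: "0 < a" "a < 1"
    and bound: "\<And>g. log_centred a g \<Longrightarrow> \<bar>\<Sum>k=1..n. \<P>(\<omega> in M. K \<omega> = k) * g k\<bar> \<le> B"
  shows "tv_dist M K N L \<le> B"
  unfolding tv_dist_def
proof (rule cSUP_least)
  fix E :: "nat set"
  interpret prob_space M by fact
  define e where "e = \<P>(\<omega> in N. L \<omega> \<in> E)"
  have sets: "{\<omega> \<in> space M. K \<omega> \<in> E} \<in> sets M" using K by measurable
  have "prob {\<omega> \<in> space M. K \<omega> \<in> E} = expectation (\<lambda>\<omega>. indicat_real E (K \<omega>))"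
  proof -
    have "expectation (\<lambda>\<omega>. indicat_real E (K \<omega>)) = expectation (indicat_real {\<omega> \<in> space M. K \<omega> \<in> E})"
      by (rule Bochner_Integration.integral_cong) (auto simp: indicator_def)
    then show ?thesis using sets by (simp add: Int_absorb1)
  qed
  also have "\<dots> = (\<Sum>k=1..n. prob {\<omega> \<in> space M. K \<omega> = k} * indicator E k)"
    by (rule expectation_finite_range[OF K]) (use range in auto)
  finally have KE: "prob {\<omega> \<in> space M. K \<omega> \<in> E} = \<dots>" .
  have "(\<Sum>k=1..n. prob {\<omega> \<in> space M. K \<omega> = k}) = 1"
    using expectation_finite_range[OF K, of "{1..n}" "\<lambda>_. 1"] range by (simp add: prob_space)
  then have "(\<Sum>k=1..n. prob {\<omega> \<in> space M. K \<omega> = k} * (indicator E k - e)) = prob {\<omega> \<in> space M. K \<omega> \<in> E} - e"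
    by (simp add: KE right_diff_distrib sum_subtractf sum_distrib_right[symmetric])
  then show "\<bar>prob {\<omega> \<in> space M. K \<omega> \<in> E} - \<P>(\<omega> in N. L \<omega> \<in> E)\<bar> \<le> B"
    using bound[OF log_distributed_centred[OF L a, of E]] by (simp add: e_def)
qed simp

section \<open>Law and factorial moments of the number of maxima\<close>

lemma falling_fact_eq_binomial: "falling_fact (real k) l = fact l * real (k choose l)"
  by (simp add: falling_fact_def binomial_gbinomial gbinomial_prod_rev atLeast0LessThan)

text \<open>  The factorial moments of the binomial law, for weights \<open>p\<close> and \<open>q\<close> that need not add up to \<open>1\<close>.\<close>

lemma binomial_falling_moment:
  fixes p q :: real
  shows "(\<Sum>k\<le>n. falling_fact (real k) l * (real (n choose k) * p ^ k * q ^ (n - k)))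
       = falling_fact (real n) l * p ^ l * (p + q) ^ (n - l)"
proof (cases "l \<le> n")
  case True
  have "(\<Sum>k\<le>n. falling_fact (real k) l * (real (n choose k) * p ^ k * q ^ (n - k)))
      = (\<Sum>k=l..n. falling_fact (real k) l * (real (n choose k) * p ^ k * q ^ (n - k)))"
    by (rule sum.mono_neutral_right) (auto simp: falling_fact_eq_binomial)
  also have "\<dots> = (\<Sum>i\<le>n - l. falling_fact (real (i + l)) l * (real (n choose (i + l)) * p ^ (i + l) * q ^ (n - (i + l))))"
  proof -
    have "(\<Sum>k=l..n. h k) = (\<Sum>i\<le>n - l. h (i + l))" for h :: "nat \<Rightarrow> real"
      using True sum.shift_bounds_cl_nat_ivl[of h 0 l "n - l"] by (simp add: atLeast0AtMost)
    then show ?thesis .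
  qed
  also have "\<dots> = (\<Sum>i\<le>n - l. falling_fact (real n) l * p ^ l * (real ((n - l) choose i) * p ^ i * q ^ (n - l - i)))"
  proof (intro sum.cong refl)
    fix i assume "i \<in> {..n - l}"
    then have "(n choose (i + l)) * ((i + l) choose l) = (n choose l) * ((n - l) choose i)"
      using True choose_mult[of l "i + l" n] by simp
    then have "real (n choose (i + l)) * real ((i + l) choose l) = real (n choose l) * real ((n - l) choose i)"
      by (metis of_nat_mult)
    then have "falling_fact (real (i + l)) l * real (n choose (i + l)) = falling_fact (real n) l * real ((n - l) choose i)"
      unfolding falling_fact_eq_binomial by (simp add: algebra_simps)
    moreover have "n - (i + l) = n - l - i" by simp
    ultimately show "falling_fact (real (i + l)) l * (real (n choose (i + l)) * p ^ (i + l) * q ^ (n - (i + l)))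
        = falling_fact (real n) l * p ^ l * (real ((n - l) choose i) * p ^ i * q ^ (n - l - i))"
      by (simp add: power_add)
  qed
  also have "\<dots> = falling_fact (real n) l * p ^ l * (p + q) ^ (n - l)"
    by (simp add: binomial_ring sum_distrib_left)
  finally show ?thesis .
next
  case False
  then have "falling_fact (real k) l = 0" if "k \<le> n" for k
    using that by (simp add: falling_fact_eq_binomial)
  then show ?thesis by simp
qed

lemma sample_max_ge: "i \<in> {1..n} \<Longrightarrow> X i \<omega> \<le> sample_max X n \<omega>"
  by (simp add: sample_max_def)

lemma sample_max_attained:
  assumes "n \<ge> 1"
  obtains i where "i \<in> {1..n}" "X i \<omega> = sample_max X n \<omega>"
proof -
  have "sample_max X n \<omega> \<in> (\<lambda>i. X i \<omega>) ` {1..n}"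
    unfolding sample_max_def using assms by (intro Max_in) auto
  then show ?thesis using that by auto
qed

lemma num_max_range:
  assumes "n \<ge> 1"
  shows "num_max X n \<omega> \<in> {1..n}"
proof -
  obtain i where "i \<in> {1..n}" "X i \<omega> = sample_max X n \<omega>" using sample_max_attained[OF assms] .
  then have "card {i \<in> {1..n}. X i \<omega> = sample_max X n \<omega>} > 0" by (auto simp: card_gt_0_iff)
  moreover have "card {i \<in> {1..n}. X i \<omega> = sample_max X n \<omega>} \<le> card {1..n}" by (intro card_mono) auto
  ultimately show ?thesis by (simp add: num_max_def)
qed

text \<open>  On the event that the maximum is \<open>j\<close> and attained exactly \<open>k\<close> times, \<open>S\<close> is the set of indices at which
  it is attained. The condition on the right has a product form, to which independence applies.\<close>

lemma num_max_sample_max_iff: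
  assumes k: "k \<ge> 1"
  shows "num_max X n \<omega> = k \<and> sample_max X n \<omega> = j \<longleftrightarrow>
    (\<exists>S. S \<subseteq> {1..n} \<and> card S = k \<and> (\<forall>i\<in>{1..n}. X i \<omega> \<in> (if i \<in> S then {j} else {..<j})))"
    (is "?L \<longleftrightarrow> ?R")
proof
  assume L: ?L
  have "X i \<omega> \<in> (if i \<in> {i \<in> {1..n}. X i \<omega> = j} then {j} else {..<j})" if "i \<in> {1..n}" for i
    using sample_max_ge[OF that, of X \<omega>] L that by (auto simp: le_less)
  then show ?R using L by (intro exI[of _ "{i \<in> {1..n}. X i \<omega> = j}"]) (auto simp: num_max_def)
next
  assume ?R
  then obtain S where S: "S \<subseteq> {1..n}" "card S = k"
    "\<And>i. i \<in> {1..n} \<Longrightarrow> X i \<omega> \<in> (if i \<in> S then {j} else {..<j})" by blast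
  have X_eq: "X i \<omega> = j" if "i \<in> S" for i using S(1) S(3)[of i] that by auto
  have X_less: "X i \<omega> < j" if "i \<in> {1..n}" "i \<notin> S" for i using S(3)[of i] that by simp
  have "S \<noteq> {}" using S k by auto
  then obtain i0 where i0: "i0 \<in> S" by blast
  have "sample_max X n \<omega> = j" unfolding sample_max_def
  proof (rule Max_eqI)
    show "j \<in> (\<lambda>i. X i \<omega>) ` {1..n}" using i0 S(1) X_eq[OF i0] by (intro image_eqI[of _ _ i0]) auto
    show "y \<le> j" if y: "y \<in> (\<lambda>i. X i \<omega>) ` {1..n}" for y
    proof -
      obtain i where "i \<in> {1..n}" "y = X i \<omega>" using y by (rule imageE)
      then show ?thesis using X_eq[of i] X_less[of i] by (cases "i \<in> S") auto
    qed
  qed simp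
  moreover have "{i \<in> {1..n}. X i \<omega> = j} = S"
  proof (intro set_eqI iffI)
    fix i assume "i \<in> {i \<in> {1..n}. X i \<omega> = j}"
    then show "i \<in> S" using X_less[of i] by auto
  next
    fix i assume "i \<in> S"
    then show "i \<in> {i \<in> {1..n}. X i \<omega> = j}" using S(1) X_eq[of i] by auto
  qed
  ultimately show ?L using S by (simp add: num_max_def)
qed

lemma num_max_measurable:
  assumes X: "\<And>i. i \<in> {1..n} \<Longrightarrow> X i \<in> measurable M (count_space (UNIV :: nat set))"
  shows "num_max X n \<in> measurable M (count_space UNIV)"
proof -
  \<comment> \<open>\<open>sample_max\<close> is eliminated in favour of comparisons between pairs of sample values.\<close>
  have "num_max X n = (\<lambda>\<omega>. card {i. i \<in> {1..n} \<and> (\<forall>l\<in>{1..n}. X l \<omega> \<le> X i \<omega>)})"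
  proof
    fix \<omega>
    have "X i \<omega> = sample_max X n \<omega> \<longleftrightarrow> (\<forall>l\<in>{1..n}. X l \<omega> \<le> X i \<omega>)" if i: "i \<in> {1..n}" for i
    proof
      assume "X i \<omega> = sample_max X n \<omega>"
      then show "\<forall>l\<in>{1..n}. X l \<omega> \<le> X i \<omega>" using sample_max_ge[of _ n X \<omega>] by simp
    next
      assume "\<forall>l\<in>{1..n}. X l \<omega> \<le> X i \<omega>"
      then show "X i \<omega> = sample_max X n \<omega>"
        unfolding sample_max_def using i by (intro Max_eqI[symmetric]) auto
    qed
    then show "num_max X n \<omega> = card {i. i \<in> {1..n} \<and> (\<forall>l\<in>{1..n}. X l \<omega> \<le> X i \<omega>)}"
      unfolding num_max_def by (intro arg_cong[where f = card]) blast
  qed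
  moreover have "(\<lambda>\<omega>. card {i. i \<in> {1..n} \<and> (\<forall>l\<in>{1..n}. X l \<omega> \<le> X i \<omega>)}) \<in> measurable M (count_space UNIV)"
  proof (rule measurable_card)
    fix i :: nat
    have le: "{\<omega> \<in> space M. X l \<omega> \<le> X i \<omega>} \<in> sets M" if "l \<in> {1..n}" "i \<in> {1..n}" for l
    proof -
      have "{\<omega> \<in> space M. X l \<omega> \<le> X i \<omega>}
          = (\<Union>a. (X l -` {..a} \<inter> space M) \<inter> (X i -` {a} \<inter> space M))" by auto
      moreover have "X l -` {..a} \<inter> space M \<in> sets M" "X i -` {a} \<inter> space M \<in> sets M" for a
        using measurable_sets[OF X[OF that(1)], of "{..a}"] measurable_sets[OF X[OF that(2)], of "{a}"]
        by simp_all
      then have "(X l -` {..a} \<inter> space M) \<inter> (X i -` {a} \<inter> space M) \<in> sets M" for a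
        by (rule sets.Int)
      then have "range (\<lambda>a. (X l -` {..a} \<inter> space M) \<inter> (X i -` {a} \<inter> space M)) \<subseteq> sets M"
        by (rule image_subsetI)
      ultimately show ?thesis by (simp only: sets.countable_nat_UN)
    qed
    show "{\<omega> \<in> space M. i \<in> {i. i \<in> {1..n} \<and> (\<forall>l\<in>{1..n}. X l \<omega> \<le> X i \<omega>)}} \<in> sets M"
    proof (cases "i \<in> {1..n}")
      case True
      have "{\<omega> \<in> space M. \<forall>l\<in>{1..n}. X l \<omega> \<le> X i \<omega>} \<in> sets M"
        using le[OF _ True] by (intro sets.sets_Collect_finite_All) auto
      then show ?thesis using True by simp
    next
      case False
      then have "{\<omega> \<in> space M. i \<in> {i. i \<in> {1..n} \<and> (\<forall>l\<in>{1..n}. X l \<omega> \<le> X i \<omega>)}} = {}" by blast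
      then show ?thesis by (simp only: sets.empty_sets)
    qed
  qed
  ultimately show ?thesis by (simp only:)
qed

text \<open>  The mass function of the number of maxima. The series starts at \<open>j = 0\<close>, where \<open>j - 1\<close> truncates to \<open>0\<close>;
  the hypothesis on \<open>F\<close> at \<open>j = 0\<close> then says \<open>F 0 = 0\<close>, as is the case for positive integer samples.\<close>

lemma (in prob_space) num_max_pmf_sums:
  fixes X :: "nat \<Rightarrow> 'a \<Rightarrow> nat"
  assumes indep: "indep_vars (\<lambda>_. count_space UNIV) X {1..n}"
    and p: "\<And>i j. i \<in> {1..n} \<Longrightarrow> prob {\<omega> \<in> space M. X i \<omega> = j} = p j"
    and F: "\<And>i j. i \<in> {1..n} \<Longrightarrow> prob {\<omega> \<in> space M. X i \<omega> < j} = F (j - 1)"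
    and k: "k \<ge> 1"
  shows "(\<lambda>j. real (n choose k) * p j ^ k * F (j - 1) ^ (n - k)) sums prob {\<omega> \<in> space M. num_max X n \<omega> = k}"
proof (cases "n \<ge> 1")
  case n: True
  have X: "X i \<in> measurable M (count_space UNIV)" if "i \<in> {1..n}" for i
    using indep that by (simp add: indep_vars_def)
  define T where "T = {S. S \<subseteq> {1..n} \<and> card S = k}"
  have T: "finite T" "card T = n choose k"
    using n_subsets[of "{1..n}" k] by (auto simp: T_def)
  define B where "B j S = (\<Inter>i\<in>{1..n}. X i -` (if i \<in> S then {j} else {..<j}) \<inter> space M)" for j S
  have B_iff: "\<omega> \<in> B j S \<longleftrightarrow> \<omega> \<in> space M \<and> (\<forall>i\<in>{1..n}. X i \<omega> \<in> (if i \<in> S then {j} else {..<j}))" for \<omega> j S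
  proof -
    have "1 \<in> {1..n}" using n by simp
    then show ?thesis unfolding B_def by blast
  qed
  have B_sets: "B j S \<in> sets M" for j S
    unfolding B_def using n measurable_sets[OF X] by (intro sets.finite_INT) auto
  have B_prob: "prob (B j S) = p j ^ k * F (j - 1) ^ (n - k)" if "S \<in> T" for j S
  proof -
    have "prob (B j S) = (\<Prod>i\<in>{1..n}. prob (X i -` (if i \<in> S then {j} else {..<j}) \<inter> space M))"
      unfolding B_def using n by (intro indep_varsD_finite[OF indep]) auto
    also have "\<dots> = (\<Prod>i\<in>{1..n}. if i \<in> S then p j else F (j - 1))"
    proof (intro prod.cong refl)
      fix i assume i: "i \<in> {1..n}"
      have "X i -` {j} \<inter> space M = {\<omega> \<in> space M. X i \<omega> = j}" "X i -` {..<j} \<inter> space M = {\<omega> \<in> space M. X i \<omega> < j}"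
        by auto
      then show "prob (X i -` (if i \<in> S then {j} else {..<j}) \<inter> space M) = (if i \<in> S then p j else F (j - 1))"
        using p[OF i] F[OF i] by simp
    qed
    also have "\<dots> = p j ^ card S * F (j - 1) ^ card ({1..n} - S)"
    proof -
      have "{1..n} \<inter> S = S" "{1..n} \<inter> {i. i \<notin> S} = {1..n} - S" using that by (auto simp: T_def)
      then show ?thesis by (simp add: prod.If_cases Compl_eq)
    qed
    also have "card ({1..n} - S) = n - k"
      using that finite_subset[of S "{1..n}"] by (simp add: T_def card_Diff_subset)
    finally show ?thesis using that by (simp add: T_def)
  qed
  define A where "A j = {\<omega> \<in> space M. num_max X n \<omega> = k \<and> sample_max X n \<omega> = j}" for j
  have A_eq: "A j = (\<Union>S\<in>T. B j S)" for j
  proof -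
    have "\<omega> \<in> A j \<longleftrightarrow> \<omega> \<in> (\<Union>S\<in>T. B j S)" for \<omega>
      unfolding A_def mem_Collect_eq num_max_sample_max_iff[OF k] T_def UN_iff B_iff by blast
    then show ?thesis by blast
  qed
  have A_prob: "prob (A j) = real (n choose k) * p j ^ k * F (j - 1) ^ (n - k)" for j
  proof -
    have "disjoint_family_on (B j) T"
    proof (unfold disjoint_family_on_def, intro ballI impI)
      fix S S' assume S: "S \<in> T" "S' \<in> T" "S \<noteq> S'"
      show "B j S \<inter> B j S' = {}"
      proof (rule ccontr)
        assume "B j S \<inter> B j S' \<noteq> {}"
        then obtain \<omega> where \<omega>: "\<omega> \<in> B j S" "\<omega> \<in> B j S'" by auto
        have S_eq: "S'' = {i \<in> {1..n}. X i \<omega> = j}" if "S'' \<in> T" "\<omega> \<in> B j S''" for S''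
        proof -
          have S'': "S'' \<subseteq> {1..n}" using that(1) by (simp add: T_def)
          have "X i \<omega> \<in> (if i \<in> S'' then {j} else {..<j})" if "i \<in> {1..n}" for i
            using \<open>\<omega> \<in> B j S''\<close> that by (simp only: B_iff)
          then have "X i \<omega> = j \<longleftrightarrow> i \<in> S''" if "i \<in> {1..n}" for i
            using that by (cases "i \<in> S''") force+
          then show ?thesis using S'' by blast
        qed
        have "S = S'" using S_eq[OF S(1) \<omega>(1)] S_eq[OF S(2) \<omega>(2)] by (rule trans[OF _ sym])
        then show False using S(3) by contradiction
      qed
    qed
    then have "prob (\<Union>S\<in>T. B j S) = (\<Sum>S\<in>T. prob (B j S))"
      using T(1) B_sets by (intro finite_measure_finite_Union image_subsetI)
    then show ?thesis using T by (simp add: A_eq B_prob)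
  qed
  have "A j \<in> sets M" for j unfolding A_eq using T(1) B_sets by (rule sets.finite_UN)
  then have "(\<lambda>j. prob (A j)) sums prob (\<Union>j. A j)"
    by (intro finite_measure_UNION image_subsetI) (auto simp: disjoint_family_on_def A_def)
  moreover have "(\<Union>j. A j) = {\<omega> \<in> space M. num_max X n \<omega> = k}" by (auto simp: A_def)
  ultimately show ?thesis by (simp add: A_prob)
next
  case False
  then have "num_max X n \<omega> = 0" for \<omega> by (simp add: num_max_def)
  moreover have zero: "real (n choose k) = 0" using False k by (simp add: binomial_eq_0)
  ultimately show ?thesis using k unfolding zero by simp
qed

text \<open>  Exchanging the finite sum over \<open>k\<close> with the series over \<open>j\<close>, the sum over \<open>k\<close> is a binomial factorial
  moment with weights \<open>p j\<close> and \<open>F (j - 1)\<close>, which add up to \<open>F j\<close>.\<close>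

lemma (in prob_space) falling_moment_sums:
  fixes X :: "nat \<Rightarrow> 'a \<Rightarrow> nat"
  assumes n: "n \<ge> 1"
    and indep: "indep_vars (\<lambda>_. count_space UNIV) X {1..n}"
    and p: "\<And>i j. i \<in> {1..n} \<Longrightarrow> prob {\<omega> \<in> space M. X i \<omega> = j} = p j"
    and F: "\<And>i j. i \<in> {1..n} \<Longrightarrow> prob {\<omega> \<in> space M. X i \<omega> < j} = F (j - 1)"
    and F_rec: "\<And>j. F j = p j + F (j - 1)"
    and l: "l \<ge> 1"
  shows "(\<lambda>j. falling_fact (real n) l * p j ^ l * F j ^ (n - l))
           sums expectation (\<lambda>\<omega>. falling_fact (real (num_max X n \<omega>)) l)"
proof -
  let ?q = "\<lambda>k. prob {\<omega> \<in> space M. num_max X n \<omega> = k}"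
  have K: "num_max X n \<in> measurable M (count_space UNIV)"
    using indep by (intro num_max_measurable) (simp add: indep_vars_def)
  have ff0: "falling_fact (real 0) l = 0" using l by (simp add: falling_fact_eq_binomial del: of_nat_0)
  have "(\<lambda>j. \<Sum>k=1..n. (real (n choose k) * p j ^ k * F (j - 1) ^ (n - k)) * falling_fact (real k) l)
      sums (\<Sum>k=1..n. ?q k * falling_fact (real k) l)"
    by (intro sums_sum sums_mult2 num_max_pmf_sums[OF indep p F]) auto
  also have "(\<Sum>k=1..n. ?q k * falling_fact (real k) l) = expectation (\<lambda>\<omega>. falling_fact (real (num_max X n \<omega>)) l)"
    by (rule expectation_finite_range[OF K, symmetric]) (rule finite_atLeastAtMost, rule num_max_range[OF n])
  also have "(\<lambda>j. \<Sum>k=1..n. (real (n choose k) * p j ^ k * F (j - 1) ^ (n - k)) * falling_fact (real k) l)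
      = (\<lambda>j. falling_fact (real n) l * p j ^ l * F j ^ (n - l))"
  proof
    fix j
    have "(\<Sum>k=1..n. (real (n choose k) * p j ^ k * F (j - 1) ^ (n - k)) * falling_fact (real k) l)
        = (\<Sum>k\<le>n. falling_fact (real k) l * (real (n choose k) * p j ^ k * F (j - 1) ^ (n - k)))"
      by (intro sum.mono_neutral_cong_left) (use ff0 in \<open>auto simp: not_le\<close>)
    then show "(\<Sum>k=1..n. (real (n choose k) * p j ^ k * F (j - 1) ^ (n - k)) * falling_fact (real k) l)
        = falling_fact (real n) l * p j ^ l * F j ^ (n - l)"
      by (simp only: binomial_falling_moment F_rec[symmetric])
  qed
  finally show ?thesis .
qed

section \<open>Comparison of the moments\<close>

lemma cauchy_schwarz_sums:
  fixes p F :: "nat \<Rightarrow> real"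
  assumes nonneg: "\<And>j. 0 \<le> p j"
    and 1: "(\<lambda>j. p j * F j ^ (m + 2)) sums A1" and 2: "(\<lambda>j. p j ^ 2 * F j ^ (m + 1)) sums A2"
    and 3: "(\<lambda>j. p j ^ 3 * F j ^ m) sums A3"
    and F: "\<And>j. 0 \<le> F j" and A1: "0 < A1"
  shows "A2\<^sup>2 \<le> A1 * A3"
proof -
  \<comment> \<open>The minimiser of the quadratic \<open>A3 - 2 r A2 + r\<^sup>2 A1\<close>.\<close>
  define r where "r = A2 / A1"
  have "(\<lambda>j. p j ^ 3 * F j ^ m - 2 * r * (p j ^ 2 * F j ^ (m + 1)) + r\<^sup>2 * (p j * F j ^ (m + 2)))
      sums (A3 - 2 * r * A2 + r\<^sup>2 * A1)"
    by (intro sums_add sums_diff sums_mult 1 2 3)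
  moreover have "p j ^ 3 * F j ^ m - 2 * r * (p j ^ 2 * F j ^ (m + 1)) + r\<^sup>2 * (p j * F j ^ (m + 2))
      = p j * F j ^ m * (p j - r * F j)\<^sup>2" for j
    by (simp add: power_add power2_eq_square power3_eq_cube algebra_simps)
  ultimately have "(\<lambda>j. p j * F j ^ m * (p j - r * F j)\<^sup>2) sums (A3 - 2 * r * A2 + r\<^sup>2 * A1)" by simp
  from sums_le[OF _ sums_zero this] have "0 \<le> A3 - 2 * r * A2 + r\<^sup>2 * A1"
    using nonneg F by simp
  also have "\<dots> = A3 - A2\<^sup>2 / A1" using A1 by (simp add: r_def power2_eq_square)
  finally show ?thesis using A1 by (simp add: field_simps)
qed

text \<open>  With \<open>w = b m2\<close> and \<open>\<tau> = (1 - b) t / b\<close>, both sides equal \<open>2 (1 + b) c\<close> times an expression in \<open>w\<close> and \<open>\<tau>\<close>,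
  namely \<open>2w/3 + \<tau>/3\<close> and \<open>2w/(n - 1) + \<tau>\<close>, and \<open>cs\<close> becomes \<open>(n - 2) w \<le> (n - 1) \<tau>\<close>.\<close>

lemma moment_bound_rearrange:
  fixes b c m2 m s t n :: real
  assumes b: "0 < b" "b < 1" and c: "0 \<le> c" and m2: "0 < m2" and n: "n \<ge> 2"
    and m: "m = (1 - b) * m2" and s: "s = m2 - m"
    and cs: "(n - 2) * s\<^sup>2 \<le> (n - 1) * (t * m)" and t: "0 \<le> t"
  shows "4 / 3 * (1 + b) * c / b * (b\<^sup>2 * m2 + (1 - b) / 2 * t)
    \<le> 2 * (1 + b) * c * m2 * (b + (1 - b) * (t / s - (n - 3) * s / ((n - 1) * m)))"
proof -
  have s': "s = b * m2" using s m by (simp add: algebra_simps)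
  define \<tau> where "\<tau> = (1 - b) * t / b"
  define w where "w = b * m2"
  have lhs: "4 / 3 * (1 + b) * c / b * (b\<^sup>2 * m2 + (1 - b) / 2 * t) = 2 * (1 + b) * c * (2 / 3 * w + 1 / 3 * \<tau>)"
    using b by (simp add: \<tau>_def w_def power2_eq_square field_simps)
  have rhs: "m2 * (b + (1 - b) * (t / s - (n - 3) * s / ((n - 1) * m))) = w + \<tau> - (n - 3) / (n - 1) * w"
  proof -
    have "m2 * ((1 - b) * (t / s)) = \<tau>" using b m2 by (simp add: s' \<tau>_def)
    moreover have "m2 * ((1 - b) * ((n - 3) * s / ((n - 1) * m))) = (n - 3) / (n - 1) * w"
      using b m2 by (simp add: s' m w_def)
    ultimately show ?thesis by (simp add: w_def algebra_simps)
  qed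
  have "2 / 3 * w + 1 / 3 * \<tau> \<le> w + \<tau> - (n - 3) / (n - 1) * w"
  proof -
    have "(n - 2) * (w * w) \<le> (n - 1) * (\<tau> * w)"
    proof -
      have "t * m = \<tau> * w" using b by (simp add: m w_def \<tau>_def)
      moreover have "s\<^sup>2 = w * w" by (simp add: s' w_def power2_eq_square)
      ultimately show ?thesis using cs by simp
    qed
    then have "w * ((n - 2) * w) \<le> w * ((n - 1) * \<tau>)" by (simp add: algebra_simps)
    then have *: "(n - 2) * w \<le> (n - 1) * \<tau>" using b m2 by (simp add: w_def)
    have "0 < w" using b m2 by (simp add: w_def)
    define u v where "u = n * w" and "v = n * \<tau>"
    have "u - 2 * w \<le> v - \<tau>" using * by (simp add: u_def v_def algebra_simps)
    then have "0 \<le> 2 * (v - \<tau>) + (u - w) - 3 * (u - 3 * w)" using \<open>0 < w\<close> by argo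
    then have "0 \<le> 2 * ((n - 1) * \<tau>) + (n - 1) * w - 3 * ((n - 3) * w)" by (simp add: u_def v_def algebra_simps)
    then show ?thesis using n by (simp add: field_simps)
  qed
  then have "2 * (1 + b) * c * (2 / 3 * w + 1 / 3 * \<tau>) \<le> 2 * (1 + b) * c * (w + \<tau> - (n - 3) / (n - 1) * w)"
    using b c by (intro mult_left_mono) auto
  then show ?thesis unfolding lhs rhs[symmetric] by (simp only: mult.assoc)
qed

section \<open>The approximation theorem\<close>

theorem theorem1:
  fixes M :: "'a measure" and X :: "nat \<Rightarrow> 'a \<Rightarrow> nat" and n :: nat
    and p F :: "nat \<Rightarrow> real" and K :: "'a \<Rightarrow> nat"
    and N :: "'b measure" and L :: "'b \<Rightarrow> nat" and \<alpha> \<beta> :: real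
  assumes "prob_space M"
    and "n \<ge> 1"
    and "prob_space.indep_vars M (\<lambda>_. count_space UNIV) X {1..n}"
    and "\<And>i. i \<in> {1..n} \<Longrightarrow>
           distr M (count_space UNIV) (X i) = distr M (count_space UNIV) (X 1)"
    and "\<And>i \<omega>. i \<in> {1..n} \<Longrightarrow> \<omega> \<in> space M \<Longrightarrow> X i \<omega> \<ge> 1"
    and "\<And>j. p j = \<P>(\<omega> in M. X 1 \<omega> = j)"
    and "\<And>j. F j = \<P>(\<omega> in M. X 1 \<omega> \<le> j)"
    and "K = num_max X n"
  shows "(1 - \<alpha> = \<P>(\<omega> in M. K \<omega> = 1) / (\<integral>\<omega>. real (K \<omega>) \<partial>M)
          \<and> 0 < \<alpha> \<and> \<alpha> < 1 \<and> log_distributed N L \<alpha> \<longrightarrow>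
          tv_dist M K N L \<le>
            - 2 * real n * ln (1 - \<alpha>) *
              (\<Sum>\<^sub>\<infinity>j\<in>{1..}. p j * (F j ^ (n - 1)
                 - (1 - \<alpha>) * (real n - 1) / \<alpha> * p j * F (j - 1) ^ (n - 2))))
       \<and> (1 - \<beta> = (\<integral>\<omega>. real (K \<omega>) \<partial>M) / (\<integral>\<omega>. real (K \<omega>) ^ 2 \<partial>M)
          \<and> 0 < \<beta> \<and> \<beta> < 1 \<and> log_distributed N L \<beta> \<longrightarrow>
          tv_dist M K N L \<le>
            - 2 * (1 + \<beta>) * ln (1 - \<beta>) * (\<integral>\<omega>. real (K \<omega>) ^ 2 \<partial>M) *
              (\<beta> + (1 - \<beta>) *
                ((\<integral>\<omega>. falling_fact (real (K \<omega>)) 3 \<partial>M) / (\<integral>\<omega>. falling_fact (real (K \<omega>)) 2 \<partial>M)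
                 - (real n - 3) * (\<integral>\<omega>. falling_fact (real (K \<omega>)) 2 \<partial>M)
                   / ((real n - 1) * (\<integral>\<omega>. real (K \<omega>) \<partial>M)))))"
proof -
  interpret prob_space M by fact
  have indep: "indep_vars (\<lambda>_. count_space UNIV) X {1..n}" by fact
  have n: "n \<ge> 1" by fact
  have X: "X i \<in> measurable M (count_space UNIV)" if "i \<in> {1..n}" for i
    using indep that by (simp add: indep_vars_def)
  have X_law: "prob {\<omega> \<in> space M. X i \<omega> \<in> A} = prob {\<omega> \<in> space M. X 1 \<omega> \<in> A}" if i: "i \<in> {1..n}" for i A
  proof -
    have "measure (distr M (count_space UNIV) (X i)) A = measure (distr M (count_space UNIV) (X 1)) A"
      using assms(4)[OF i] by simp
    moreover have "{\<omega> \<in> space M. X i \<omega> \<in> A} = X i -` A \<inter> space M" for i by auto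
    ultimately show ?thesis using X[OF i] X[of 1] n by (simp add: measure_distr)
  qed
  have p: "prob {\<omega> \<in> space M. X i \<omega> = j} = p j" if "i \<in> {1..n}" for i j
    using X_law[OF that, of "{j}"] assms(6) by simp
  have F_less: "prob {\<omega> \<in> space M. X i \<omega> < j} = F (j - 1)" if "i \<in> {1..n}" for i j
  proof -
    have "{\<omega> \<in> space M. X 1 \<omega> < j} = {\<omega> \<in> space M. X 1 \<omega> \<le> j - 1}"
    proof -
      have "X 1 \<omega> \<ge> 1" if "\<omega> \<in> space M" for \<omega> using assms(5)[of 1 \<omega>] n that by simp
      then show ?thesis by (cases j) (fastforce simp: less_Suc_eq_le)+
    qed
    then show ?thesis using X_law[OF that, of "{..<j}"] assms(7) by simp
  qed
  have p0: "p 0 = 0"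
  proof -
    have empty: "{\<omega> \<in> space M. X 1 \<omega> = 0} = {}" using assms(5)[of 1] n by force
    show ?thesis unfolding assms(6) empty by simp
  qed
  have F_rec: "F j = p j + F (j - 1)" for j
  proof -
    have X1: "X 1 \<in> measurable M (count_space UNIV)" using X n by simp
    have "{\<omega> \<in> space M. X 1 \<omega> \<le> j} = {\<omega> \<in> space M. X 1 \<omega> = j} \<union> {\<omega> \<in> space M. X 1 \<omega> < j}" by auto
    moreover have "{\<omega> \<in> space M. X 1 \<omega> = j} \<in> sets M" "{\<omega> \<in> space M. X 1 \<omega> < j} \<in> sets M"
      using X1 by measurable
    ultimately have "F j = p j + prob {\<omega> \<in> space M. X 1 \<omega> < j}"
      unfolding assms(6,7) by (auto intro!: finite_measure_Union)
    then show ?thesis using F_less[of 1 j] n by simp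
  qed
  have p_nonneg: "0 \<le> p j" and F_nonneg: "0 \<le> F j" for j by (simp_all add: assms(6,7))

  have K: "K \<in> measurable M (count_space UNIV)"
    unfolding assms(8) by (rule num_max_measurable) (rule X)
  have range: "K \<omega> \<in> {1..n}" for \<omega> unfolding assms(8) by (rule num_max_range[OF n])
  \<comment> \<open>\<open>Q\<close> is \<open>m\<close> times the size-biased law of \<open>K\<close>.\<close>
  define q where "q k = prob {\<omega> \<in> space M. K \<omega> = k}" for k
  define Q where "Q k = real k * q k" for k
  define m where "m = expectation (\<lambda>\<omega>. real (K \<omega>))"
  define m2 where "m2 = expectation (\<lambda>\<omega>. real (K \<omega>) ^ 2)"
  define s where "s = expectation (\<lambda>\<omega>. falling_fact (real (K \<omega>)) 2)"
  define t where "t = expectation (\<lambda>\<omega>. falling_fact (real (K \<omega>)) 3)"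
  have E: "expectation (\<lambda>\<omega>. f (K \<omega>)) = (\<Sum>k=1..n. q k * f k)" for f :: "nat \<Rightarrow> real"
    unfolding q_def by (rule expectation_finite_range[OF K]) (rule finite_atLeastAtMost, rule range)
  have q_nonneg: "0 \<le> q k" for k by (simp add: q_def)
  have Q_nonneg: "0 \<le> Q k" for k by (simp add: Q_def q_nonneg)
  have m_eq: "m = (\<Sum>k=1..n. Q k)"
    using E[of real] by (simp add: m_def Q_def mult.commute)
  have m2_eq: "m2 = (\<Sum>k=1..n. real k * Q k)"
    using E[of "\<lambda>k. real k ^ 2"] by (simp add: m2_def Q_def power2_eq_square mult.commute mult.left_commute)
  have ff: "falling_fact x 1 = x" "falling_fact x 2 = x * (x - 1)" "falling_fact x 3 = x * (x - 1) * (x - 2)" for x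
    by (simp_all add: falling_fact_def numeral_2_eq_2 numeral_3_eq_3)
  have s_eq: "s = m2 - m"
  proof -
    have "s = (\<Sum>k=1..n. q k * (real k * (real k - 1)))"
      using E[of "\<lambda>k. falling_fact (real k) 2"] by (simp add: s_def ff)
    also have "\<dots> = m2 - m" unfolding m2_eq m_eq sum_subtractf[symmetric]
      by (intro sum.cong refl) (simp add: Q_def algebra_simps)
    finally show ?thesis .
  qed
  have t_eq: "t = (\<Sum>k=1..n. (real k - 1) * (real k - 2) * Q k)"
  proof -
    have "t = (\<Sum>k=1..n. q k * (real k * (real k - 1) * (real k - 2)))"
      using E[of "\<lambda>k. falling_fact (real k) 3"] by (simp add: t_def ff)
    also have "\<dots> = (\<Sum>k=1..n. (real k - 1) * (real k - 2) * Q k)"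
      by (intro sum.cong refl) (simp add: Q_def mult_ac)
    finally show ?thesis .
  qed
  have t_nonneg: "0 \<le> t" unfolding t_eq
  proof (intro sum_nonneg mult_nonneg_nonneg[OF _ Q_nonneg])
    fix k assume "k \<in> {1..n}"
    then show "0 \<le> (real k - 1) * (real k - 2)" by (cases "k = 1") auto
  qed
  have m_ge: "1 \<le> m"
  proof -
    have "(\<Sum>k=1..n. q k) = 1" using E[of "\<lambda>_. 1"] by (simp add: prob_space)
    moreover have "(\<Sum>k=1..n. q k) \<le> (\<Sum>k=1..n. Q k)"
    proof (rule sum_mono)
      fix k assume "k \<in> {1..n}"
      then show "q k \<le> Q k" using mult_right_mono[of 1 "real k" "q k"] q_nonneg by (simp add: Q_def)
    qed
    ultimately show ?thesis by (simp only: m_eq)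
  qed

  note moment = falling_moment_sums[OF n indep p F_less F_rec, folded assms(8)]
  have mom1: "(\<lambda>j. real n * (p j * F j ^ (n - 1))) sums m"
    using moment[of 1] by (simp add: ff[unfolded One_nat_def] m_def mult.assoc)
  have mom2: "(\<lambda>j. real n * (real n - 1) * (p j ^ 2 * F j ^ (n - 2))) sums s"
    using moment[of 2] by (simp add: ff s_def mult.assoc)
  have mom3: "(\<lambda>j. real n * (real n - 1) * (real n - 2) * (p j ^ 3 * F j ^ (n - 3))) sums t"
    using moment[of 3] by (simp add: ff t_def mult.assoc)

  have TV: "tv_dist M K N L \<le> B"
    if L: "log_distributed N L a" and a: "0 < a" "a < 1"
      and bound: "\<And>g. log_centred a g \<Longrightarrow>
        \<bar>\<Sum>k=1..n. Q k * (a * log_stein a g (Suc k) - log_stein a g k)\<bar> \<le> B" for a B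
  proof (rule tv_dist_le[OF \<open>prob_space M\<close> K range L a])
    fix g assume g: "log_centred a g"
    have "q k * g k = Q k * (a * log_stein a g (Suc k) - log_stein a g k)" if "k \<in> {1..n}" for k
      using log_stein_rec[of a k g] a that by (simp add: Q_def mult_ac)
    then have "(\<Sum>k=1..n. q k * g k) = (\<Sum>k=1..n. Q k * (a * log_stein a g (Suc k) - log_stein a g k))"
      by (intro sum.cong) auto
    then show "\<bar>\<Sum>k=1..n. prob {\<omega> \<in> space M. K \<omega> = k} * g k\<bar> \<le> B"
      using bound[OF g] by (simp only: q_def)
  qed

  \<comment> \<open>The series in the bound equals \<open>(m - (1 - a) / a * Q 2) / n\<close>, by the first moment and the mass
    function of \<open>K\<close> at \<open>2\<close>.\<close>
  have a_part: "tv_dist M K N L \<le>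
      - 2 * real n * ln (1 - a) *
        (\<Sum>\<^sub>\<infinity>j\<in>{1..}. p j * (F j ^ (n - 1) - (1 - a) * (real n - 1) / a * p j * F (j - 1) ^ (n - 2)))"
    if a_def: "1 - a = q 1 / m" and a: "0 < a" "a < 1" and L: "log_distributed N L a" for a
  proof -
    have q1: "Q 1 = (1 - a) * m" using a_def m_ge by (simp add: Q_def)
    have n2: "n \<ge> 2"
    proof (rule ccontr)
      assume "\<not> n \<ge> 2"
      then have "n = 1" using n by simp
      then have "Q 1 = m" by (simp add: m_eq)
      then show False using q1 a m_ge by simp
    qed
    let ?S = "\<Sum>\<^sub>\<infinity>j\<in>{1..}. p j * (F j ^ (n - 1) - (1 - a) * (real n - 1) / a * p j * F (j - 1) ^ (n - 2))"
    have "((\<lambda>j. real n * (p j * F j ^ (n - 1))) has_sum m) UNIV"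
      using mom1 by (rule sums_nonneg_imp_has_sum) (simp add: p_nonneg F_nonneg)
    then have h1: "((\<lambda>j. p j * F j ^ (n - 1)) has_sum m / real n) UNIV"
      using n by (subst (asm) has_sum_cmult_right_iff) auto
    have ch: "real (n choose 2) = real n * (real n - 1) / 2"
      using falling_fact_eq_binomial[of n 2] by (simp add: ff fact_2)
    have "(\<lambda>j. real (n choose 2) * p j ^ 2 * F (j - 1) ^ (n - 2)) sums q 2"
      unfolding q_def assms(8) by (rule num_max_pmf_sums[OF indep p F_less]) auto
    then have "((\<lambda>j. real (n choose 2) * p j ^ 2 * F (j - 1) ^ (n - 2)) has_sum q 2) UNIV"
      by (rule sums_nonneg_imp_has_sum) (simp add: p_nonneg F_nonneg)
    note q2_scaled = has_sum_cmult_right[OF this, of "2 * (1 - a) / (a * real n)"]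
    have h2: "((\<lambda>j. (1 - a) * (real n - 1) / a * (p j ^ 2 * F (j - 1) ^ (n - 2))) has_sum
        (2 * (1 - a) / (a * real n) * q 2)) UNIV"
    proof -
      have "2 * (1 - a) / (a * real n) * (real (n choose 2) * x * y) = (1 - a) * (real n - 1) / a * (x * y)" for x y
        using n2 a by (simp add: ch field_simps)
      then show ?thesis using q2_scaled by (simp only:)
    qed
    have "x * (u - c * x * v) = x * u + - 1 * (c * (x\<^sup>2 * v))" for x u c v :: real
      by (simp add: power2_eq_square algebra_simps)
    then have "((\<lambda>j. p j * (F j ^ (n - 1) - (1 - a) * (real n - 1) / a * p j * F (j - 1) ^ (n - 2)))
        has_sum (m / real n + - 1 * (2 * (1 - a) / (a * real n) * q 2))) UNIV"
      using has_sum_add[OF h1 has_sum_cmult_right[OF h2, of "- 1"]] by (simp only:)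
    then have "((\<lambda>j. p j * (F j ^ (n - 1) - (1 - a) * (real n - 1) / a * p j * F (j - 1) ^ (n - 2)))
        has_sum (m / real n + - 1 * (2 * (1 - a) / (a * real n) * q 2))) {1..}"
      by (rule has_sum_cong_neutral[THEN iffD1, rotated -1]) (auto simp: p0 not_le)
    then have S: "?S = m / real n + - 1 * (2 * (1 - a) / (a * real n) * q 2)" by (rule infsumI)
    have "tv_dist M K N L \<le> 2 * a * (- ln (1 - a) / a) * (m - (1 - a) / a * Q 2)"
    proof (rule TV[OF L a])
      fix g assume g: "log_centred a g"
      show "\<bar>\<Sum>k=1..n. Q k * (a * log_stein a g (Suc k) - log_stein a g k)\<bar>
          \<le> 2 * a * (- ln (1 - a) / a) * (m - (1 - a) / a * Q 2)"
        unfolding m_eq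
        by (rule stein_sum_bound_of_first_mass[OF n2 a Q_nonneg q1[unfolded m_eq]])
          (rule log_stein_1 log_stein_bound[OF a g])+
    qed
    also have "\<dots> = - 2 * real n * ln (1 - a) * ?S"
      unfolding S using a n by (simp add: Q_def field_simps)
    finally show ?thesis .
  qed

  have b_part: "tv_dist M K N L \<le> - 2 * (1 + b) * ln (1 - b) * m2 *
      (b + (1 - b) * (t / s - (real n - 3) * s / ((real n - 1) * m)))"
    if b_def: "1 - b = m / m2" and b: "0 < b" "b < 1" and L: "log_distributed N L b" for b
  proof -
    have m2_pos: "0 < m2"
      using b_def b m_ge by (metis diff_gt_0_iff_gt less_le_trans zero_less_divide_iff zero_less_one not_less_iff_gr_or_eq)
    have m: "m = (1 - b) * m2" using b_def m2_pos by simp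
    have n2: "n \<ge> 2"
    proof (rule ccontr)
      assume "\<not> n \<ge> 2"
      then have "n = 1" using n by simp
      then have "m2 = m" by (simp add: m_eq m2_eq)
      then show False using m b m2_pos by simp
    qed
    have cs: "(real n - 2) * s\<^sup>2 \<le> (real n - 1) * (t * m)"
    proof (cases "n = 2")
      \<comment> \<open>Here the left-hand side is \<open>0\<close>; the exponent \<open>n - 3\<close> in \<open>mom3\<close> would truncate.\<close>
      case True
      then show ?thesis using t_nonneg m_ge by simp
    next
      case False
      then obtain l where l: "n = l + 3" using n2 by (metis add.commute le_Suc_ex le_antisym not_less_eq_eq numeral_2_eq_2 numeral_3_eq_3)
      let ?N1 = "real n" and ?N2 = "real n * (real n - 1)" and ?N3 = "real n * (real n - 1) * (real n - 2)"
      have N: "0 < ?N1" "0 < ?N2" "0 < ?N3" using l by auto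
      have unscale: "f sums (x / c)" if "(\<lambda>j. c * f j) sums x" "0 < c" for f :: "nat \<Rightarrow> real" and x c
        using sums_divide[OF that(1), of c] that(2) by simp
      have exps: "n - 1 = l + 2" "n - 2 = l + 1" "n - 3 = l" using l by auto
      note A = unscale[OF mom1 N(1), unfolded exps] unscale[OF mom2 N(2), unfolded exps]
        unscale[OF mom3 N(3), unfolded exps]
      have "(s / ?N2)\<^sup>2 \<le> (m / ?N1) * (t / ?N3)"
        by (rule cauchy_schwarz_sums[OF p_nonneg A F_nonneg]) (use N m_ge in auto)
      then have "(s / ?N2)\<^sup>2 * (?N2\<^sup>2 * (real n - 2)) \<le> (m / ?N1) * (t / ?N3) * (?N2\<^sup>2 * (real n - 2))"
        by (rule mult_right_mono) (use l in simp)
      moreover have "(s / y)\<^sup>2 * (y\<^sup>2 * z) = z * s\<^sup>2" if "y \<noteq> 0" for y z :: real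
        using that by (simp add: power_divide)
      moreover have "(m / x) * (t / (x * y * z)) * ((x * y)\<^sup>2 * z) = y * (t * m)"
        if "x \<noteq> 0" "y \<noteq> 0" "z \<noteq> 0" for x y z :: real
        using that by (simp add: power2_eq_square)
      moreover have "real n - 1 \<noteq> 0" "real n - 2 \<noteq> 0" using l by auto
      ultimately show ?thesis using N by (metis less_irrefl)
    qed
    let ?c = "- ln (1 - b)"
    have "tv_dist M K N L \<le> 4 / 3 * (1 + b) * ?c / b * (b\<^sup>2 * m2 + (1 - b) / 2 * t)"
    proof (rule TV[OF L b])
      fix g assume g: "log_centred b g"
      show "\<bar>\<Sum>k=1..n. Q k * (b * log_stein b g (Suc k) - log_stein b g k)\<bar>
          \<le> 4 / 3 * (1 + b) * ?c / b * (b\<^sup>2 * m2 + (1 - b) / 2 * t)"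
        unfolding m2_eq t_eq
        by (rule stein_sum_bound_of_mean[OF b Q_nonneg m[unfolded m_eq m2_eq]])
          (rule log_stein_1, rule log_stein_diff_bound[OF b g])
    qed
    also have "\<dots> \<le> 2 * (1 + b) * ?c * m2 * (b + (1 - b) * (t / s - (real n - 3) * s / ((real n - 1) * m)))"
      by (rule moment_bound_rearrange[OF b _ m2_pos _ m s_eq cs t_nonneg]) (use b n2 in auto)
    finally show ?thesis by (simp only: mult_minus_left mult_minus_right)
  qed

  show ?thesis
    using a_part[of \<alpha>] b_part[of \<beta>] unfolding q_def m_def m2_def s_def t_def by blast
qed

end
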